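(* Let $m$ be a nonnegative integer, and let $C$ and $D$ be sets of nonnegative integers such that $C \cup D = [0, m]$, $C \cap D = \emptyset$ and $0 \in C$. Then $R_{C}(n) = R_{D}(n)$ for every positive integer $n$ if and only if there exists a natural number $l$ such that $C = A_{l}$ and $D = B_{l}$.
   Context: Natural numbers are nonnegative integers, $\mathbb{N} = \{0,1,2,\dots\}$, and $[a,b]$ denotes the set of integers $x$ with $a \le x \le b$. For a set $S$ of nonnegative integers, $R_S(n)$ denotes the number of solutions of $s + s' = n$ with $s, s' \in S$ and $s < s'$. $A$ is the set of those nonnegative integers whose binary representation contains an even number of digits $1$ (so $0 \in A$), and $B = \mathbb{N} \setminus A$. For a natural number $l$, $A_l = A \cap [0, 2^l - 1]$ and $B_l = B \cap [0, 2^l - 1]$. *)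

theory Defs
  imports Main
begin

definition repr_count :: "nat set \<Rightarrow> nat \<Rightarrow> nat" where
  "repr_count S n = card {(s, s'). s \<in> S \<and> s' \<in> S \<and> s < s' \<and> s + s' = n}"

(* bit n i says that the binary digit of n at position i is 1; for a natural
   number n only finitely many digits are 1, so the cardinality counts them. *)
definition setA :: "nat set" where
  "setA = {n. even (card {i. bit n i})}"

definition setB :: "nat set" where
  "setB = UNIV - setA"

definition A_upto :: "nat \<Rightarrow> nat set" where
  "A_upto l = setA \<inter> {0..2 ^ l - 1}"

definition B_upto :: "nat \<Rightarrow> nat set" where
  "B_upto l = setB \<inter> {0..2 ^ l - 1}"

end

theory Submission
  imports Defs
begin

text \<open>
  Let \<open>f\<close> be the signed indicator (\<open>1\<close> on \<open>C\<close>, \<open>-1\<close> on \<open>D\<close>, \<open>0\<close> elsewhere) and \<open>N = m + 1\<close>.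
  In terms of generating functions, \<open>R\<^sub>C = R\<^sub>D\<close> says
  \<open>f(x) (1 + x + \<dots> + x\<^sup>m) = f(x\<^sup>2)\<close>, that is,
  \<open>f(x) (1 - x\<^sup>N) = (1 - x) f(x\<^sup>2)\<close>. Comparing coefficients below \<open>N\<close> forces \<open>f\<close> to be the
  Thue-Morse sequence \<open>t\<close> on \<open>[0, m]\<close>; the coefficients from \<open>N\<close> on then say
  \<open>t (j + N) = - t j\<close> for all \<open>j < N\<close>. This holds iff \<open>N\<close> is a power of two: factors of two
  can be cancelled, and for odd \<open>N \<ge> 3\<close> the cases \<open>j = 0, 1, 2\<close> are contradictory.
\<close>

section \<open>The Thue-Morse sequence and antiperiodicity\<close>

definition thue_morse :: "nat \<Rightarrow> int" where
  "thue_morse n = (if n \<in> setA then 1 else -1)"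

lemma finite_bits_nat: "finite {i. bit (n::nat) i}"
proof -
  have "{i. bit n i} \<subseteq> {..n}"
  proof
    fix i assume "i \<in> {i. bit n i}"
    then have "\<not> n < 2 ^ i" by (auto simp: bit_iff_odd)
    then have "i \<le> n" using less_exp[of i] by linarith
    then show "i \<in> {..n}" by simp
  qed
  then show ?thesis using finite_subset by blast
qed

lemma zero_in_setA: "0 \<in> setA"
proof -
  have "{i. bit (0::nat) i} = {}" by simp
  then show ?thesis unfolding setA_def by (simp only: mem_Collect_eq card.empty even_zero)
qed

lemma double_in_setA_iff: "2 * n \<in> setA \<longleftrightarrow> n \<in> setA"
proof -
  have "{i. bit (2 * n) i} = Suc ` {i. bit n i}" (is "?L = ?R")
  proof (rule set_eqI)
    show "i \<in> ?L \<longleftrightarrow> i \<in> ?R" for i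
      by (cases i) (auto simp: bit_Suc bit_0)
  qed
  then show ?thesis by (simp add: setA_def card_image)
qed

lemma Suc_double_in_setA_iff: "Suc (2 * n) \<in> setA \<longleftrightarrow> n \<notin> setA"
proof -
  have "{i. bit (Suc (2 * n)) i} = insert 0 (Suc ` {i. bit n i})" (is "?L = ?R")
  proof (rule set_eqI)
    show "i \<in> ?L \<longleftrightarrow> i \<in> ?R" for i
      by (cases i) (auto simp: bit_Suc bit_0)
  qed
  then show ?thesis by (simp add: setA_def card_image finite_bits_nat)
qed

lemma thue_morse_0: "thue_morse 0 = 1"
  by (simp add: thue_morse_def zero_in_setA)

lemma thue_morse_double: "thue_morse (2 * n) = thue_morse n"
  by (simp add: thue_morse_def double_in_setA_iff)

lemma thue_morse_Suc_double: "thue_morse (Suc (2 * n)) = - thue_morse n"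
  by (simp add: thue_morse_def Suc_double_in_setA_iff)

text \<open>Both parities in one formula, shaped like the right-hand side of the coefficient
  recurrence for the signed indicator.\<close>

lemma thue_morse_rec: "thue_morse n = (-1) ^ n * thue_morse (n div 2)"
proof (cases "even n")
  case True
  then show ?thesis using thue_morse_double[of "n div 2"] by simp
next
  case False
  then show ?thesis using thue_morse_Suc_double[of "n div 2"] by simp
qed

text \<open>The sum has exactly one more digit 1. The induction drops the last digit: adding the
  even number \<open>2 ^ Suc l\<close> keeps the parity of \<open>j\<close>, and halving leaves the
  case \<open>l\<close>.\<close>

lemma thue_morse_add_power_2: "j < 2 ^ l \<Longrightarrow> thue_morse (j + 2 ^ l) = - thue_morse j"
proof (induction l arbitrary: j)
  case 0
  then show ?case using thue_morse_Suc_double[of 0] by simp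
next
  case (Suc l)
  have "thue_morse (2 ^ l + j div 2) = - thue_morse (j div 2)"
    using Suc.IH[of "j div 2"] Suc.prems by (simp add: add.commute)
  then show ?case
    by (subst (1 2) thue_morse_rec) (simp add: power_add)
qed

lemma thue_morse_antiperiodic_imp_power_2:
  assumes "N > 0" and "\<forall>j<N. thue_morse (j + N) = - thue_morse j"
  shows "\<exists>l. N = 2 ^ l"
  using assms
proof (induction N rule: less_induct)
  case (less N)
  show ?case
  proof (cases "even N")
    case True
    then obtain M where M: "N = 2 * M" by blast
    have "\<forall>j<M. thue_morse (j + M) = - thue_morse j"
    proof (intro allI impI)
      fix j assume "j < M"
      then have "thue_morse (2 * j + 2 * M) = - thue_morse (2 * j)"
        using less.prems M by simp
      then show "thue_morse (j + M) = - thue_morse j"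
        using thue_morse_double[of "j + M"] thue_morse_double[of j] by (simp add: algebra_simps)
    qed
    then obtain l where "M = 2 ^ l"
      using less.IH[of M] less.prems M by auto
    then have "N = 2 ^ Suc l" using M by simp
    then show ?thesis by blast
  next
    case False
    then obtain v where v: "N = Suc (2 * v)" by (auto elim: oddE)
    show ?thesis
    proof (cases "v = 0")
      case True
      then have "N = 2 ^ 0" using v by simp
      then show ?thesis by blast
    next
      case False
      \<comment> \<open>Here \<open>N\<close> is at least 3, so 1 and 2 are admissible. The numbers
        \<open>1 + N\<close> and \<open>2 + N\<close> differ only in the last digit and get opposite
        signs, whereas 1 and 2 have the same sign.\<close>
      have anti: "thue_morse (1 + N) = - thue_morse 1" "thue_morse (2 + N) = - thue_morse 2"
        using spec[OF less.prems(2), of 1] spec[OF less.prems(2), of 2] False v by simp_all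
      have "thue_morse (1 + N) = thue_morse (Suc v)" "thue_morse (2 + N) = - thue_morse (Suc v)"
        using thue_morse_double[of "Suc v"] thue_morse_Suc_double[of "Suc v"] v by simp_all
      moreover have "thue_morse 1 = -1" "thue_morse 2 = -1"
        using thue_morse_Suc_double[of 0] thue_morse_double[of 1] thue_morse_0 by simp_all
      ultimately show ?thesis using anti by simp
    qed
  qed
qed

section \<open>Representation counts as sums of the signed indicator\<close>

definition signed_indicator :: "'a set \<Rightarrow> 'a set \<Rightarrow> 'a \<Rightarrow> int" where
  "signed_indicator C D i = (if i \<in> C then 1 else 0) - (if i \<in> D then 1 else 0)"

lemma repr_count_alt:
  "repr_count S n = card {i. 2 * i < n \<and> i \<in> S \<and> n - i \<in> S}"
proof -
  have "bij_betw fst {(s, s'). s \<in> S \<and> s' \<in> S \<and> s < s' \<and> s + s' = n}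
      {i. 2 * i < n \<and> i \<in> S \<and> n - i \<in> S}"
    by (rule bij_betw_byWitness[where f' = "\<lambda>i. (i, n - i)"]) auto
  then show ?thesis by (simp add: repr_count_def bij_betw_same_card)
qed

text \<open>A pair inside \<open>C\<close> counts 2, one inside \<open>D\<close> counts -2 and a
  mixed one 0, which is the sum of the two signs. Summing over all pairs covers every admissible
  index except the midpoint \<open>n div 2\<close>, which is therefore subtracted.\<close>

lemma repr_count_diff:
  fixes C D :: "nat set"
  assumes "C \<union> D = {0..m}" "C \<inter> D = {}"
  shows "2 * (int (repr_count C n) - int (repr_count D n)) =
    (\<Sum>i | i \<le> n \<and> n - i \<le> m. signed_indicator C D i) -
    (if even n then signed_indicator C D (n div 2) else 0)"
proof -
  let ?f = "signed_indicator C D"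
  \<comment> \<open>Indices below, above and at the midpoint; the reflection of \<open>i\<close> to
    \<open>n - i\<close> swaps \<open>Q\<close> and \<open>Q'\<close>.\<close>
  define Q where "Q = {i. 2 * i < n \<and> i \<le> m \<and> n - i \<le> m}"
  define Q' where "Q' = {i. i \<le> n \<and> n < 2 * i \<and> i \<le> m \<and> n - i \<le> m}"
  define M where "M = {i. i \<le> m \<and> 2 * i = n}"
  have fin: "finite Q" "finite Q'" "finite M"
    by (auto simp: Q_def Q'_def M_def intro: finite_subset[of _ "{..m}"])
  have mem: "i \<le> m \<longleftrightarrow> i \<in> C \<or> i \<in> D" for i using assms(1) by auto
  have zero: "?f i = 0" if "\<not> i \<le> m" for i
    using that mem by (simp add: signed_indicator_def)
  have count: "int (repr_count S n) = (\<Sum>i\<in>Q. if i \<in> S \<and> n - i \<in> S then 1 else 0)"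
    if "S \<subseteq> {0..m}" for S
  proof -
    have "{i. 2 * i < n \<and> i \<in> S \<and> n - i \<in> S} = {i \<in> Q. i \<in> S \<and> n - i \<in> S}"
      using that by (auto simp: Q_def)
    then show ?thesis using fin by (simp add: repr_count_alt sum.If_cases Int_def)
  qed
  have "2 * (int (repr_count C n) - int (repr_count D n)) =
      (\<Sum>i\<in>Q. 2 * ((if i \<in> C \<and> n - i \<in> C then 1 else 0) - (if i \<in> D \<and> n - i \<in> D then 1 else 0)))"
    using assms(1) by (subst (1 2) count) (auto simp: sum_subtractf sum_distrib_left)
  also have "\<dots> = (\<Sum>i\<in>Q. ?f i + ?f (n - i))"
  proof (rule sum.cong[OF refl])
    fix i assume "i \<in> Q"
    then have "i \<in> C \<or> i \<in> D" "n - i \<in> C \<or> n - i \<in> D" by (auto simp: Q_def mem)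
    then show "2 * ((if i \<in> C \<and> n - i \<in> C then 1 else 0) -
        (if i \<in> D \<and> n - i \<in> D then 1 else 0)) = ?f i + ?f (n - i)"
      using assms(2) by (auto simp: signed_indicator_def)
  qed
  also have "\<dots> = sum ?f Q + (\<Sum>i\<in>Q. ?f (n - i))" by (simp add: sum.distrib)
  also have "(\<Sum>i\<in>Q. ?f (n - i)) = sum ?f Q'"
    by (rule sum.reindex_bij_witness[where i = "\<lambda>i. n - i" and j = "\<lambda>i. n - i"])
       (auto simp: Q_def Q'_def)
  finally have main: "2 * (int (repr_count C n) - int (repr_count D n)) = sum ?f Q + sum ?f Q'" .
  \<comment> \<open>The left index set allows \<open>i\<close> beyond \<open>m\<close>, where the
    indicator vanishes.\<close>
  have "(\<Sum>i | i \<le> n \<and> n - i \<le> m. ?f i) = sum ?f (Q \<union> Q' \<union> M)"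
    by (rule sum.mono_neutral_right) (use zero in \<open>force simp: Q_def Q'_def M_def\<close>)+
  also have "\<dots> = sum ?f (Q \<union> Q') + sum ?f M"
    by (rule sum.union_disjoint) (use fin in \<open>auto simp: Q_def Q'_def M_def\<close>)
  also have "sum ?f (Q \<union> Q') = sum ?f Q + sum ?f Q'"
    by (rule sum.union_disjoint) (use fin in \<open>auto simp: Q_def Q'_def\<close>)
  also have "sum ?f M = (if even n then ?f (n div 2) else 0)"
  proof (cases "even n \<and> n div 2 \<le> m")
    case True
    then have "M = {n div 2}" by (auto simp: M_def)
    then show ?thesis using True by simp
  next
    case False
    then have "M = {}" by (auto simp: M_def)
    then show ?thesis using False zero by auto
  qed
  finally show ?thesis using main by simp
qed

text \<open>The coefficientwise form of \<open>f(x) (1 - x\<^sup>N) = (1 - x) f(x\<^sup>2)\<close>, where \<open>N = m + 1\<close>.\<close>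

lemma repr_count_eq_iff:
  fixes C D :: "nat set"
  assumes "C \<union> D = {0..m}" "C \<inter> D = {}"
  defines "f \<equiv> signed_indicator C D"
  shows "(\<forall>n. repr_count C n = repr_count D n) \<longleftrightarrow>
    (\<forall>n. f n - (if m < n then f (n - Suc m) else 0) = (-1) ^ n * f (n div 2))"
proof -
  \<comment> \<open>\<open>W\<close> and \<open>g\<close> are the coefficients of the two sides
    before multiplication by \<open>1 - x\<close>, which amounts to taking consecutive
    differences.\<close>
  define W where "W n = (\<Sum>i | i \<le> n \<and> n - i \<le> m. f i)" for n
  define g where "g n = (if even n then f (n div 2) else 0)" for n
  have "2 * (int (repr_count C n) - int (repr_count D n)) = W n - g n" for n
    using repr_count_diff[OF assms(1,2), of n] by (simp add: W_def g_def f_def)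
  then have "repr_count C n = repr_count D n \<longleftrightarrow> W n = g n" for n
    by (metis diff_self eq_iff_diff_eq_0 mult_eq_0_iff of_nat_eq_iff zero_neq_numeral)
  then have iff: "(\<forall>n. repr_count C n = repr_count D n) \<longleftrightarrow> (\<forall>n. W n = g n)" by simp
  have W0: "W 0 = g 0"
  proof -
    have "{i. i \<le> 0 \<and> 0 - i \<le> m} = {0}" by auto
    then show ?thesis by (simp add: W_def g_def)
  qed
  have step: "W (Suc n) - W n = f (Suc n) - (if m < Suc n then f (Suc n - Suc m) else 0)" for n
  proof -
    \<comment> \<open>The common part of two consecutive windows: \<open>Suc n\<close> enters, and
      \<open>n - m\<close> leaves once \<open>m \<le> n\<close>.\<close>
    define K where "K = {i. i \<le> n \<and> Suc n - i \<le> m}"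
    have K: "finite K" by (simp add: K_def)
    have "{i. i \<le> Suc n \<and> Suc n - i \<le> m} = insert (Suc n) K"
      by (auto simp: K_def)
    then have a: "W (Suc n) = f (Suc n) + sum f K"
      using K by (simp add: W_def K_def)
    have b: "W n = sum f K + (if m \<le> n then f (n - m) else 0)"
    proof (cases "m \<le> n")
      case True
      then have "{i. i \<le> n \<and> n - i \<le> m} = insert (n - m) K" by (auto simp: K_def)
      moreover have "n - m \<notin> K" using True by (auto simp: K_def)
      ultimately show ?thesis using K True by (simp add: W_def)
    next
      case False
      then have "{i. i \<le> n \<and> n - i \<le> m} = K" by (auto simp: K_def)
      then show ?thesis using False by (simp add: W_def)
    qed
    show ?thesis using a b by (simp add: less_Suc_eq_le)
  qed
  \<comment> \<open>Exactly one of \<open>n\<close> and \<open>Suc n\<close> is even, and half of it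
    is \<open>Suc n div 2\<close> in either case.\<close>
  have gstep: "g (Suc n) - g n = (-1) ^ Suc n * f (Suc n div 2)" for n
    by (cases "even n") (auto simp: g_def)
  have "(\<forall>n. W n = g n) \<longleftrightarrow> (\<forall>n. W (Suc n) - W n = g (Suc n) - g n)"
  proof (intro iffI allI)
    fix n assume *: "\<forall>n. W (Suc n) - W n = g (Suc n) - g n"
    show "W n = g n"
    proof (induction n)
      case (Suc n)
      then show ?case using spec[OF *, of n] by simp
    qed (rule W0)
  qed simp
  also have "\<dots> \<longleftrightarrow>
      (\<forall>n. f (Suc n) - (if m < Suc n then f (Suc n - Suc m) else 0) = (-1) ^ Suc n * f (Suc n div 2))"
    unfolding step gstep ..
  also have "\<dots> \<longleftrightarrow>
      (\<forall>n. f n - (if m < n then f (n - Suc m) else 0) = (-1) ^ n * f (n div 2))"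
    (is "(\<forall>n. ?P (Suc n)) \<longleftrightarrow> (\<forall>n. ?P n)")
  proof -
    have "?P 0" by simp
    then show ?thesis by (metis not0_implies_Suc)
  qed
  finally show ?thesis using iff by simp
qed

section \<open>Partitions of an initial interval with equal counts\<close>

lemma repr_count_0: "repr_count S 0 = 0"
  by (simp add: repr_count_alt)

theorem theorem3:
  fixes m :: nat and C D :: "nat set"
  assumes "C \<union> D = {0..m}"
    and "C \<inter> D = {}"
    and "0 \<in> C"
  shows "(\<forall>n::nat. n > 0 \<longrightarrow> repr_count C n = repr_count D n) \<longleftrightarrow>
         (\<exists>l::nat. C = A_upto l \<and> D = B_upto l)"
proof -
  define f where "f = signed_indicator C D"
  have zero: "f n = 0" if "m < n" for n
  proof -
    have "n \<notin> C \<union> D" using that unfolding assms(1) by simp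
    then show ?thesis by (simp add: f_def signed_indicator_def)
  qed
  have "(\<forall>n::nat. n > 0 \<longrightarrow> repr_count C n = repr_count D n) \<longleftrightarrow>
      (\<forall>n. repr_count C n = repr_count D n)"
    by (metis repr_count_0 gr0I)
  also have "\<dots> \<longleftrightarrow>
      (\<forall>n. f n - (if m < n then f (n - Suc m) else 0) = (-1) ^ n * f (n div 2))"
    unfolding f_def by (rule repr_count_eq_iff[OF assms(1,2)])
  also have "\<dots> \<longleftrightarrow> (\<exists>l::nat. C = A_upto l \<and> D = B_upto l)"
  proof
    assume rec: "\<forall>n. f n - (if m < n then f (n - Suc m) else 0) = (-1) ^ n * f (n div 2)"
    \<comment> \<open>Up to \<open>m\<close> the shifted term is absent, so the recurrence
      determines \<open>f n\<close> from \<open>f (n div 2)\<close>; the initial value 1 comes from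
      \<open>0 \<in> C\<close>.\<close>
    have f_tm: "f n = thue_morse n" if "n \<le> m" for n
      using that
    proof (induction n rule: less_induct)
      case (less n)
      show ?case
      proof (cases "n = 0")
        case True
        then show ?thesis
          using assms(2,3) by (auto simp: f_def signed_indicator_def thue_morse_0)
      next
        case False
        then have "f (n div 2) = thue_morse (n div 2)" using less by simp
        then show ?thesis
          using spec[OF rec, of n] less.prems thue_morse_rec[of n] by simp
      qed
    qed
    \<comment> \<open>At \<open>j + Suc m\<close> the indicator is 0, so only the shifted term
      \<open>- f j\<close> remains on the left, while half the index is still at most
      \<open>m\<close>.\<close>
    have "thue_morse (j + Suc m) = - thue_morse j" if "j < Suc m" for j
    proof -
      have "(j + Suc m) div 2 \<le> m" using that by simp
      then show ?thesis
        using spec[OF rec, of "j + Suc m"] that f_tm zero[of "j + Suc m"]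
          thue_morse_rec[of "j + Suc m"] by simp
    qed
    then obtain l where l: "Suc m = 2 ^ l"
      using thue_morse_antiperiodic_imp_power_2[of "Suc m"] by auto
    then have m: "2 ^ l - 1 = m" by (metis diff_Suc_1)
    have C: "n \<in> C \<longleftrightarrow> n \<le> m \<and> n \<in> setA" and D: "n \<in> D \<longleftrightarrow> n \<le> m \<and> n \<notin> setA" for n
    proof -
      have "n \<in> C \<or> n \<in> D \<longleftrightarrow> n \<le> m" "\<not> (n \<in> C \<and> n \<in> D)" using assms(1,2) by auto
      then show "n \<in> C \<longleftrightarrow> n \<le> m \<and> n \<in> setA" "n \<in> D \<longleftrightarrow> n \<le> m \<and> n \<notin> setA"
        using f_tm[of n] by (auto simp: f_def signed_indicator_def thue_morse_def split: if_splits)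
    qed
    have "C = A_upto l"
      unfolding A_upto_def m by (rule set_eqI) (simp add: C conj_commute)
    moreover have "D = B_upto l"
      unfolding B_upto_def setB_def m by (rule set_eqI) (simp add: D conj_commute)
    ultimately show "\<exists>l. C = A_upto l \<and> D = B_upto l" by blast
  next
    assume "\<exists>l. C = A_upto l \<and> D = B_upto l"
    then obtain l where C: "C = A_upto l" and D: "D = B_upto l" by blast
    have "A_upto l \<union> B_upto l = {0..2 ^ l - 1}"
      unfolding A_upto_def B_upto_def setB_def by blast
    then have "{0..m} = {0..2 ^ l - 1}" using assms(1) C D by simp
    then have m: "m = 2 ^ l - 1" by (simp only: Icc_eq_Icc) simp
    then have N: "Suc m = 2 ^ l" by simp
    have f_tm: "f n = thue_morse n" if "n \<le> m" for n
      using that unfolding m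
      by (simp add: f_def signed_indicator_def thue_morse_def C D A_upto_def B_upto_def setB_def)
    show "\<forall>n. f n - (if m < n then f (n - Suc m) else 0) = (-1) ^ n * f (n div 2)"
    proof
      fix n
      \<comment> \<open>In the last range \<open>n\<close>, \<open>n - Suc m\<close> and
        \<open>n div 2\<close> all exceed \<open>m\<close>, so every term is 0.\<close>
      consider "n \<le> m" | j where "n = j + Suc m" "j \<le> m" | "n \<ge> 2 * Suc m"
      proof (cases "m < n \<and> n < 2 * Suc m")
        case True
        then show ?thesis by (intro that(2)[of "n - Suc m"]) auto
      qed (use that in linarith)
      then show "f n - (if m < n then f (n - Suc m) else 0) = (-1) ^ n * f (n div 2)"
      proof cases
        case 1
        then show ?thesis using f_tm[of n] f_tm[of "n div 2"] thue_morse_rec[of n] by simp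
      next
        case 2
        then have "thue_morse n = - thue_morse j"
          using thue_morse_add_power_2[of j l] N by simp
        then show ?thesis
          using 2 f_tm[of j] f_tm[of "n div 2"] zero[of n] thue_morse_rec[of n] by simp
      next
        case 3
        then show ?thesis by (simp add: zero)
      qed
    qed
  qed
  finally show ?thesis .
qed

end
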